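(* Let $I=[a,b]\subset\mathbb{R}$ be a compact interval and let $f:I\to\mathbb{R}$. Then $f$ is Sequential Henstock integrable on $I$ if and only if there is a sequence of gauges $\{\delta_n(x)\}_{n=1}^\infty$ on $I$ such that for every $\epsilon>0$ there exists $N\in\mathbb{N}$ such that for all $n\ge N$ and all $\delta_n(x)$-fine tagged partitions $P_n$ and $Q_n$ of $I$ we have $$|S(f,P_n)-S(f,Q_n)|<\epsilon.$$
   Context: A tagged partition $P=\{([x_{i-1},x_i],t_i)\}_{i=1}^k$ of $I=[a,b]$ consists of points $a=x_0<x_1<\dots<x_k=b$ together with tags $t_i\in[x_{i-1},x_i]$. Its Riemann sum for $f$ is $S(f,P)=\sum_{i=1}^k f(t_i)(x_i-x_{i-1})$. A gauge on $I$ is a function $\delta:I\to\mathbb{R}$ with $\delta(x)>0$ for all $x\in I$. $P$ is $\delta(x)$-fine if $x_i-x_{i-1}<\delta(t_i)$ for every $i$. $f$ is Sequential Henstock integrable on $I$ with integral $A\in\mathbb{R}$ if there is a sequence of gauges $\{\delta_n\}_{n=1}^\infty$ on $I$ such that, whenever $P_n$ is a $\delta_n(x)$-fine tagged partition of $I$ for each $n$, one has $S(f,P_n)\to A$ as $n\to\infty$. *)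

theory Defs
  imports "HOL-Analysis.Analysis"
begin

text \<open>
  A tagged partition is represented as in \<^const>\<open>tagged_division_of\<close>: a set of pairs
  (tag, closed interval).  In contrast to the library notion, the subintervals are nondegenerate.
  For \<open>a = b\<close> the only tagged partition is the empty one (\<open>k = 0\<close>).
\<close>

definition tagged_partition :: "real \<Rightarrow> real \<Rightarrow> (real \<times> real set) set \<Rightarrow> bool" where
  "tagged_partition a b P \<longleftrightarrow>
     (\<exists>(k::nat) (x::nat \<Rightarrow> real) (t::nat \<Rightarrow> real).
        x 0 = a \<and> x k = b \<and>
        (\<forall>i\<in>{1..k}. x (i - 1) < x i \<and> t i \<in> {x (i - 1)..x i}) \<and>
        P = (\<lambda>i. (t i, {x (i - 1)..x i})) ` {1..k})"

definition riemann_sum :: "(real \<Rightarrow> real) \<Rightarrow> (real \<times> real set) set \<Rightarrow> real" where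
  "riemann_sum f P = (\<Sum>(t, K)\<in>P. f t * measure lborel K)"

text \<open>
  Gauges are positive real-valued functions here, unlike the open-set-valued
  \<^const>\<open>gauge\<close> of the library, and fineness bounds the length of a subinterval,
  unlike \<^const>\<open>fine\<close>.
\<close>

definition real_gauge_on :: "real set \<Rightarrow> (real \<Rightarrow> real) \<Rightarrow> bool" where
  "real_gauge_on I \<delta> \<longleftrightarrow> (\<forall>x\<in>I. \<delta> x > 0)"

definition length_fine :: "(real \<Rightarrow> real) \<Rightarrow> (real \<times> real set) set \<Rightarrow> bool" where
  "length_fine \<delta> P \<longleftrightarrow> (\<forall>(t, K)\<in>P. measure lborel K < \<delta> t)"

definition has_seq_henstock_integral ::
    "(real \<Rightarrow> real) \<Rightarrow> real \<Rightarrow> real \<Rightarrow> real \<Rightarrow> bool" where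
  "has_seq_henstock_integral f a b A \<longleftrightarrow>
     (\<exists>\<delta> :: nat \<Rightarrow> real \<Rightarrow> real.
        (\<forall>n. real_gauge_on {a..b} (\<delta> n)) \<and>
        (\<forall>P. (\<forall>n. tagged_partition a b (P n) \<and> length_fine (\<delta> n) (P n)) \<longrightarrow>
             (\<lambda>n. riemann_sum f (P n)) \<longlonglongrightarrow> A))"

definition seq_henstock_integrable :: "(real \<Rightarrow> real) \<Rightarrow> real \<Rightarrow> real \<Rightarrow> bool" where
  "seq_henstock_integrable f a b \<longleftrightarrow> (\<exists>A. has_seq_henstock_integral f a b A)"

lemma partition_points_less:
  fixes x :: "nat \<Rightarrow> real"
  assumes "\<And>i. i \<in> {1..k} \<Longrightarrow> x (i - 1) < x i" and "i < j" and "j \<le> k"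
  shows "x i < x j"
  using assms(2,3)
proof (induction j)
  case (Suc j)
  have "x j < x (Suc j)" using assms(1)[of "Suc j"] Suc.prems by simp
  then show ?case using Suc by (cases "i = j") force+
qed simp

lemma partition_points_mono:
  fixes x :: "nat \<Rightarrow> real"
  assumes "\<And>i. i \<in> {1..k} \<Longrightarrow> x (i - 1) < x i" and "i \<le> j" and "j \<le> k"
  shows "x i \<le> x j"
  using partition_points_less[of k x i j] assms by (cases "i = j") force+

lemma riemann_sum_partition_points:
  fixes x t :: "nat \<Rightarrow> real"
  assumes less: "\<And>i. i \<in> {1..k} \<Longrightarrow> x (i - 1) < x i"
  shows "riemann_sum f ((\<lambda>i. (t i, {x (i - 1)..x i})) ` {1..k}) =
           (\<Sum>i=1..k. f (t i) * (x i - x (i - 1)))"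
proof -
  have "inj_on (\<lambda>i. (t i, {x (i - 1)..x i})) {1..k}"
  proof (rule inj_onI)
    fix i j assume ij: "i \<in> {1..k}" "j \<in> {1..k}"
      and "(t i, {x (i - 1)..x i}) = (t j, {x (j - 1)..x j})"
    then have "x i = x j" using less[of i] less[of j] by (simp add: Icc_eq_Icc)
    then show "i = j"
      using partition_points_less[of k x i j] partition_points_less[of k x j i] less ij
      by (metis atLeastAtMost_iff less_irrefl linorder_neqE_nat)
  qed
  then show ?thesis
    unfolding riemann_sum_def
    by (simp add: sum.reindex) (rule sum.cong, use less in \<open>auto simp: less_imp_le\<close>)
qed

lemma tagged_partition_imp_tagged_division_of:
  assumes "tagged_partition a b P" and "a < b"
  shows "P tagged_division_of {a..b}"
  using assms(1) unfolding tagged_partition_def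
proof (elim exE conjE)
  fix k :: nat and x t :: "nat \<Rightarrow> real"
  assume x: "x 0 = a" "x k = b"
    and pts: "\<forall>i\<in>{1..k}. x (i - 1) < x i \<and> t i \<in> {x (i - 1)..x i}"
    and P: "P = (\<lambda>i. (t i, {x (i - 1)..x i})) ` {1..k}"
  have less: "x (i - 1) < x i" and tag: "t i \<in> {x (i - 1)..x i}" if "i \<in> {1..k}" for i
    using pts that by blast+
  have mono: "x i \<le> x j" if "i \<le> j" "j \<le> k" for i j
    using partition_points_mono[of k x i j] less that by blast
  have un: "(\<Union>i\<in>{1..j}. {x (i - 1)..x i}) = {x 0..x j}" if "0 < j" "j \<le> k" for j
    using that
  proof (induction j)
    case (Suc j)
    show ?case
    proof (cases "j = 0")
      case False
      have "(\<Union>i\<in>{1..Suc j}. {x (i - 1)..x i}) = {x 0..x j} \<union> {x j..x (Suc j)}"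
        using Suc False by (simp add: atLeastAtMostSuc_conv Un_commute)
      also have "\<dots> = {x 0..x (Suc j)}"
        using mono[of 0 j] mono[of j "Suc j"] Suc.prems by (intro ivl_disj_un_two_touch) auto
      finally show ?thesis .
    qed simp
  qed simp
  have "0 < k" using x assms(2) by (cases k) auto
  have "\<Union>{K. \<exists>s. (s, K) \<in> P} = (\<Union>i\<in>{1..k}. {x (i - 1)..x i})"
    unfolding P by blast
  then have cover: "\<Union>{K. \<exists>s. (s, K) \<in> P} = {a..b}"
    using un[of k] x \<open>0 < k\<close> by simp
  have disj: "interior {x (i - 1)..x i} \<inter> interior {x (j - 1)..x j} = {}"
    if "i \<in> {1..k}" "j \<in> {1..k}" "i < j" for i j
  proof -
    have "x i \<le> x (j - 1)" using that by (intro mono) auto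
    then show ?thesis by auto
  qed
  show ?thesis
  proof (rule tagged_division_ofI)
    show "finite P" by (simp add: P)
    show "\<Union>{K. \<exists>s. (s, K) \<in> P} = {a..b}" by (rule cover)
  next
    fix s K assume sK: "(s, K) \<in> P"
    then obtain i where i: "i \<in> {1..k}" "s = t i" "K = {x (i - 1)..x i}" unfolding P by blast
    show "s \<in> K" using tag i by blast
    show "K \<subseteq> {a..b}" using cover sK by blast
    show "\<exists>c d. K = cbox c d" using i by auto
    fix s' K' assume "(s', K') \<in> P" "(s, K) \<noteq> (s', K')"
    then obtain j where j: "j \<in> {1..k}" "K' = {x (j - 1)..x j}" "i \<noteq> j"
      using i unfolding P by blast
    then show "interior K \<inter> interior K' = {}"
      using disj[of i j] disj[of j i] i by (metis Int_commute linorder_neqE_nat)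
  qed
qed

end

theory Submission
  imports Defs
begin

text \<open>
  By Cousin's lemma every gauge admits a fine tagged partition. This turns both directions into
  statements about sequences.

  If the integral is \<open>A\<close>, then the Riemann sums over \<open>\<delta> n\<close>-fine partitions tend to \<open>A\<close>
  uniformly in the partition: otherwise one could choose a bad partition for infinitely many \<open>n\<close>,
  fill up the remaining indices with arbitrary fine partitions, and obtain a sequence whose Riemann
  sums stay away from \<open>A\<close>. The triangle inequality then gives the Cauchy condition.

  Conversely, the Cauchy condition only compares partitions that are fine for the same gauge, so it
  does not by itself relate different indices. Replacing \<open>\<delta> n\<close> by the minimum of
  \<open>\<delta> 0, \<dots>, \<delta> n\<close> repairs this: a partition fine for the \<open>n\<close>-th new gauge is fine for every
  \<open>\<delta> m\<close> with \<open>m \<le> n\<close>. Hence the Riemann sums of one chosen sequence of fine partitions form a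
  Cauchy sequence, and its limit is the limit for every other such sequence.
\<close>

section \<open>Existence of fine tagged partitions\<close>

lemma tagged_partition_refl: "tagged_partition a a {}"
  unfolding tagged_partition_def by (intro exI[of _ 0] exI[of _ "\<lambda>_. a"]) simp

lemma tagged_partition_single:
  assumes "a < b" and "t \<in> {a..b}"
  shows "tagged_partition a b {(t, {a..b})}"
  unfolding tagged_partition_def
  by (intro exI[of _ 1] exI[of _ "\<lambda>i. if i = 0 then a else b"] exI[of _ "\<lambda>_. t"])
    (use assms in auto)

lemma tagged_partition_Un:
  assumes "tagged_partition a b P" and "tagged_partition b c Q"
  shows "tagged_partition a c (P \<union> Q)"
proof -
  obtain k and x t :: "nat \<Rightarrow> real" where
    x: "x 0 = a" "x k = b" "\<And>i. i \<in> {1..k} \<Longrightarrow> x (i - 1) < x i \<and> t i \<in> {x (i - 1)..x i}"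
    and P: "P = (\<lambda>i. (t i, {x (i - 1)..x i})) ` {1..k}"
    using assms(1) unfolding tagged_partition_def by blast
  obtain l and y s :: "nat \<Rightarrow> real" where
    y: "y 0 = b" "y l = c" "\<And>i. i \<in> {1..l} \<Longrightarrow> y (i - 1) < y i \<and> s i \<in> {y (i - 1)..y i}"
    and Q: "Q = (\<lambda>i. (s i, {y (i - 1)..y i})) ` {1..l}"
    using assms(2) unfolding tagged_partition_def by blast
  define z where "z i = (if i \<le> k then x i else y (i - k))" for i
  define r where "r i = (if i \<le> k then t i else s (i - k))" for i
  have low: "z (i - 1) = x (i - 1)" "z i = x i" "r i = t i" if "i \<in> {1..k}" for i
    using that by (auto simp: z_def r_def)
  \<comment> \<open>For \<open>j = 1\<close> the left end point is the common point \<open>x k = y 0\<close>.\<close>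
  have high: "z (j + k - 1) = y (j - 1)" "z (j + k) = y j" "r (j + k) = s j"
    if "j \<in> {1..l}" for j
    using that x(2) y(1) by (cases "j = 1"; auto simp: z_def r_def)+
  have split: "{1..k + l} = {1..k} \<union> (\<lambda>j. j + k) ` {1..l}"
    by (auto simp: image_iff)
  have "z 0 = a" "z (k + l) = c"
    using x y by (auto simp: z_def)
  moreover have "\<forall>i\<in>{1..k + l}. z (i - 1) < z i \<and> r i \<in> {z (i - 1)..z i}"
    unfolding split ball_Un ball_simps using x(3) y(3) low high by metis
  moreover have "P \<union> Q = (\<lambda>i. (r i, {z (i - 1)..z i})) ` {1..k + l}"
    unfolding split image_Un image_image P Q
    by (intro arg_cong2[where f = "(\<union>)"] image_cong refl) (simp_all only: low high)
  ultimately show ?thesis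
    unfolding tagged_partition_def by blast
qed

text \<open>
  Cousin's lemma. Near each point \<open>x\<close> a short interval tagged by \<open>x\<close> is a fine partition, and
  fine partitions of adjacent intervals can be joined; compactness of \<open>{a..b}\<close>, in the form of the
  Bolzano bisection principle, does the rest.
\<close>

lemma fine_tagged_partition_exists:
  assumes "a \<le> b" and "real_gauge_on {a..b} \<delta>"
  shows "\<exists>P. tagged_partition a b P \<and> length_fine \<delta> P"
  using \<open>a \<le> b\<close>
proof (induction rule: Bolzano)
  case (trans u v w)
  then obtain P Q where "tagged_partition u v P" "length_fine \<delta> P"
    "tagged_partition v w Q" "length_fine \<delta> Q" by blast
  then have "tagged_partition u w (P \<union> Q)" "length_fine \<delta> (P \<union> Q)"
    by (auto intro: tagged_partition_Un simp: length_fine_def)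
  then show ?case by blast
next
  case (local x)
  have "\<exists>P. tagged_partition u v P \<and> length_fine \<delta> P"
    if "u \<le> x" "x \<le> v" "v - u < \<delta> x" for u v
  proof (cases "u = v")
    case True
    then show ?thesis using tagged_partition_refl by (auto simp: length_fine_def)
  next
    case False
    then show ?thesis using that
      by (intro exI[of _ "{(x, {u..v})}"]) (auto simp: length_fine_def tagged_partition_single)
  qed
  moreover have "\<delta> x > 0" using assms(2) local by (auto simp: real_gauge_on_def)
  ultimately show ?case by blast
qed

section \<open>The Cauchy criterion\<close>

text \<open>
  Convergence along every choice of fine partitions is automatically uniform, because the choices at
  different indices are independent: bad partitions at infinitely many indices can be collected
  into a single sequence.
\<close>

lemma fine_riemann_sums_tendsto_uniformly:
  assumes "a \<le> b" and gauge: "\<And>n. real_gauge_on {a..b} (\<delta> n)"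
    and lim: "\<And>P. (\<And>n. tagged_partition a b (P n) \<and> length_fine (\<delta> n) (P n)) \<Longrightarrow>
                (\<lambda>n. riemann_sum f (P n)) \<longlonglongrightarrow> A"
    and "\<epsilon> > 0"
  shows "\<exists>N. \<forall>n\<ge>N. \<forall>P. tagged_partition a b P \<and> length_fine (\<delta> n) P \<longrightarrow>
           \<bar>riemann_sum f P - A\<bar> < \<epsilon>"
proof -
  define bad where "bad n P \<longleftrightarrow> tagged_partition a b P \<and> length_fine (\<delta> n) P \<and>
    \<not> \<bar>riemann_sum f P - A\<bar> < \<epsilon>" for n P
  have "\<exists>P. tagged_partition a b P \<and> length_fine (\<delta> n) P \<and> ((\<exists>Q. bad n Q) \<longrightarrow> bad n P)" for n
    using fine_tagged_partition_exists[OF \<open>a \<le> b\<close> gauge[of n]] unfolding bad_def by metis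
  then obtain P where P: "\<And>n. tagged_partition a b (P n) \<and> length_fine (\<delta> n) (P n)"
    and P_bad: "\<And>n Q. bad n Q \<Longrightarrow> bad n (P n)" by metis
  obtain N where "\<And>n. n \<ge> N \<Longrightarrow> \<bar>riemann_sum f (P n) - A\<bar> < \<epsilon>"
    using LIMSEQ_D[OF lim[OF P] \<open>\<epsilon> > 0\<close>] by auto
  then have "\<not> bad n Q" if "n \<ge> N" for n Q
    using P_bad[of n Q] that unfolding bad_def by blast
  then show ?thesis unfolding bad_def by blast
qed

lemma seq_henstock_integrable_imp_Cauchy:
  assumes "a \<le> b" and "seq_henstock_integrable f a b"
  shows "\<exists>\<delta> :: nat \<Rightarrow> real \<Rightarrow> real.
       (\<forall>n. real_gauge_on {a..b} (\<delta> n)) \<and>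
       (\<forall>\<epsilon>>0. \<exists>N. \<forall>n\<ge>N. \<forall>P Q.
          tagged_partition a b P \<and> length_fine (\<delta> n) P \<and>
          tagged_partition a b Q \<and> length_fine (\<delta> n) Q \<longrightarrow>
          \<bar>riemann_sum f P - riemann_sum f Q\<bar> < \<epsilon>)"
proof -
  obtain A \<delta> where gauge: "\<And>n. real_gauge_on {a..b} (\<delta> n)"
    and lim: "\<And>P. (\<And>n. tagged_partition a b (P n) \<and> length_fine (\<delta> n) (P n)) \<Longrightarrow>
                (\<lambda>n. riemann_sum f (P n)) \<longlonglongrightarrow> A"
    using assms(2) unfolding seq_henstock_integrable_def has_seq_henstock_integral_def by blast
  have "\<exists>N. \<forall>n\<ge>N. \<forall>P Q. tagged_partition a b P \<and> length_fine (\<delta> n) P \<and>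
          tagged_partition a b Q \<and> length_fine (\<delta> n) Q \<longrightarrow>
          \<bar>riemann_sum f P - riemann_sum f Q\<bar> < \<epsilon>" if "\<epsilon> > 0" for \<epsilon>
  proof -
    have "\<exists>N. \<forall>n\<ge>N. \<forall>P. tagged_partition a b P \<and> length_fine (\<delta> n) P \<longrightarrow>
        \<bar>riemann_sum f P - A\<bar> < \<epsilon> / 2"
      by (rule fine_riemann_sums_tendsto_uniformly[OF \<open>a \<le> b\<close>]) (use gauge lim that in auto)
    then obtain N where N: "\<And>n P. \<lbrakk>n \<ge> N; tagged_partition a b P; length_fine (\<delta> n) P\<rbrakk>
        \<Longrightarrow> \<bar>riemann_sum f P - A\<bar> < \<epsilon> / 2"
      by blast
    have "\<bar>riemann_sum f P - riemann_sum f Q\<bar> < \<epsilon>"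
      if "n \<ge> N" "tagged_partition a b P" "length_fine (\<delta> n) P"
        "tagged_partition a b Q" "length_fine (\<delta> n) Q" for n P Q
      using N[OF that(1,2,3)] N[OF that(1,4,5)] by linarith
    then show ?thesis by blast
  qed
  then show ?thesis using gauge by blast
qed

lemma Cauchy_imp_seq_henstock_integrable:
  fixes \<delta> :: "nat \<Rightarrow> real \<Rightarrow> real"
  assumes "a \<le> b" and gauge: "\<And>n. real_gauge_on {a..b} (\<delta> n)"
    and Cauchy: "\<And>\<epsilon>. \<epsilon> > 0 \<Longrightarrow> \<exists>N. \<forall>n\<ge>N. \<forall>P Q.
          tagged_partition a b P \<and> length_fine (\<delta> n) P \<and>
          tagged_partition a b Q \<and> length_fine (\<delta> n) Q \<longrightarrow>
          \<bar>riemann_sum f P - riemann_sum f Q\<bar> < \<epsilon>"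
  shows "seq_henstock_integrable f a b"
proof -
  define \<gamma> where "\<gamma> n x = Min ((\<lambda>m. \<delta> m x) ` {..n})" for n x
  have \<gamma>_gauge: "real_gauge_on {a..b} (\<gamma> n)" for n
    using gauge by (auto simp: real_gauge_on_def \<gamma>_def)
  have \<gamma>_le: "\<gamma> n x \<le> \<delta> m x" if "m \<le> n" for m n x
    unfolding \<gamma>_def by (rule Min_le) (use that in auto)
  have fine: "length_fine (\<delta> m) P" if "length_fine (\<gamma> n) P" "m \<le> n" for m n P
    using that \<gamma>_le[OF that(2)] unfolding length_fine_def by (fastforce intro: less_le_trans)
  \<comment> \<open>With the decreasing gauges, partitions at different late indices become comparable: both
    are fine for the single gauge \<open>\<delta> N\<close>.\<close>
  have cmp: "\<exists>N. \<forall>m\<ge>N. \<forall>n\<ge>N. \<forall>P Q.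
      tagged_partition a b P \<longrightarrow> length_fine (\<gamma> m) P \<longrightarrow>
      tagged_partition a b Q \<longrightarrow> length_fine (\<gamma> n) Q \<longrightarrow>
      \<bar>riemann_sum f P - riemann_sum f Q\<bar> < \<epsilon>" if "\<epsilon> > 0" for \<epsilon>
    using Cauchy[OF that] fine by (meson order_refl)
  obtain P where P: "\<And>n. tagged_partition a b (P n)" "\<And>n. length_fine (\<gamma> n) (P n)"
    using fine_tagged_partition_exists[OF \<open>a \<le> b\<close> \<gamma>_gauge] by metis
  have "Cauchy (\<lambda>n. riemann_sum f (P n))"
    by (rule CauchyI) (use cmp P in \<open>metis real_norm_def\<close>)
  then obtain A where A: "(\<lambda>n. riemann_sum f (P n)) \<longlonglongrightarrow> A"
    using Cauchy_convergent convergent_def by blast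
  have "(\<lambda>n. riemann_sum f (Q n)) \<longlonglongrightarrow> A"
    if Q: "\<And>n. tagged_partition a b (Q n) \<and> length_fine (\<gamma> n) (Q n)" for Q
  proof -
    have "(\<lambda>n. riemann_sum f (Q n) - riemann_sum f (P n)) \<longlonglongrightarrow> 0"
      by (rule LIMSEQ_I) (use cmp P Q in \<open>metis diff_zero real_norm_def\<close>)
    from tendsto_add[OF this A] show ?thesis by simp
  qed
  then show ?thesis
    unfolding seq_henstock_integrable_def has_seq_henstock_integral_def using \<gamma>_gauge by blast
qed

theorem theorem7:
  fixes f :: "real \<Rightarrow> real" and a b :: real
  assumes "a \<le> b"
  shows "seq_henstock_integrable f a b \<longleftrightarrow>
    (\<exists>\<delta> :: nat \<Rightarrow> real \<Rightarrow> real.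
       (\<forall>n. real_gauge_on {a..b} (\<delta> n)) \<and>
       (\<forall>\<epsilon>>0. \<exists>N. \<forall>n\<ge>N. \<forall>P Q.
          tagged_partition a b P \<and> length_fine (\<delta> n) P \<and>
          tagged_partition a b Q \<and> length_fine (\<delta> n) Q \<longrightarrow>
          \<bar>riemann_sum f P - riemann_sum f Q\<bar> < \<epsilon>))"
  using seq_henstock_integrable_imp_Cauchy[OF assms] Cauchy_imp_seq_henstock_integrable[OF assms]
  by blast

end
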